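(* Let $f:\mathbb{R}\to\mathbb{R}$ and $g:\mathbb{R}\to\mathbb{R}$ be nonconstant, continuous functions satisfying the following conditions: (i) $f$ is periodic; (ii) there exist sequences of real numbers $\{x_n\}_{n\ge 1}$ and $\{y_n\}_{n\ge 1}$ such that $$\inf_{n}|x_n-y_n|>0\quad\text{and}\quad \lim_{n\to\infty}\left|\frac{g(x_n)-g(y_n)}{x_n-y_n}\right|=\infty.$$ Then the function $h=f\circ g:\mathbb{R}\to\mathbb{R}$ is not periodic.
   Context: A function $\phi:\mathbb{R}\to\mathbb{R}$ is called periodic if there exists a real number $T>0$ (a period of $\phi$) such that $\phi(x+T)=\phi(x)$ for all $x\in\mathbb{R}$. *)

theory Defs
  imports "HOL-Analysis.Analysis"
begin

definition periodic :: "(real \<Rightarrow> real) \<Rightarrow> bool" where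
  "periodic \<phi> \<longleftrightarrow> (\<exists>T>0. \<forall>x. \<phi> (x + T) = \<phi> x)"

end

(* If f o g were periodic, it would be uniformly continuous. Were g to vary by a full period of f
   over arbitrarily short intervals, f o g would take all values of f on each of them; so g varies
   boundedly on intervals of some fixed length. Hence |g u - g v| grows at most linearly in |u - v|,
   and the difference quotients of g are bounded over pairs of points that stay apart. *)
theory Submission
  imports Defs "HOL-Library.Periodic_Fun"
begin

lemma periodic_representative:
  fixes f :: "real \<Rightarrow> 'a"
  assumes T: "T > 0" and per: "\<And>x. f (x + T) = f x"
  obtains a' where "p \<le> a'" "a' \<le> p + T" "f a' = f a"
proof -
  interpret periodic_fun_simple f T by standard (rule per)
  define k where "k = \<lceil>(p - a) / T\<rceil>"
  have "(p - a) / T \<le> k" "k \<le> (p - a) / T + 1" unfolding k_def by linarith+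
  then have "p \<le> a + of_int k * T" "a + of_int k * T \<le> p + T"
    using T by (simp_all add: field_simps)
  then show ?thesis using that plus_of_int by blast
qed

text \<open>Heine-Cantor applies on a compact interval slightly longer than one period. Two nearby
  points are carried into it by the same multiple of \<open>S\<close>, which leaves their distance
  and their values unchanged.\<close>

lemma uniformly_continuous_periodic:
  fixes h :: "real \<Rightarrow> 'a::metric_space"
  assumes cont: "continuous_on UNIV h" and S: "S > 0" and per: "\<And>x. h (x + S) = h x"
  shows "uniformly_continuous_on UNIV h"
  unfolding uniformly_continuous_on_def
proof (intro allI impI)
  fix e :: real assume "e > 0"
  interpret periodic_fun_simple h S by standard (rule per)
  have "uniformly_continuous_on {-1..S+1} h"
    by (intro compact_uniformly_continuous continuous_on_subset[OF cont]) auto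
  then obtain d where d: "d > 0"
    "\<And>x y. x \<in> {-1..S+1} \<Longrightarrow> y \<in> {-1..S+1} \<Longrightarrow> dist y x < d \<Longrightarrow> dist (h y) (h x) < e"
    using \<open>e > 0\<close> unfolding uniformly_continuous_on_def by metis
  \<comment> \<open>\<open>x\<close> is moved into [0, S]; the cap 1 on the distance then keeps the
    shifted \<open>y\<close> within the margin of {-1..S+1}.\<close>
  have "dist (h y) (h x) < e" if "dist y x < min d 1" for x y
  proof -
    define k where "k = \<lceil>- x / S\<rceil>"
    have "- x / S \<le> k" "k \<le> - x / S + 1" unfolding k_def by linarith+
    then have "0 \<le> x + of_int k * S" "x + of_int k * S \<le> S"
      using S by (simp_all add: field_simps)
    then have "dist (h (y + of_int k * S)) (h (x + of_int k * S)) < e"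
      using that by (intro d) (auto simp: dist_real_def)
    then show ?thesis by (simp add: plus_of_int)
  qed
  then show "\<exists>d>0. \<forall>x\<in>UNIV. \<forall>y\<in>UNIV. dist y x < d \<longrightarrow> dist (h y) (h x) < e"
    using d(1) by (intro exI[of _ "min d 1"]) auto
qed

text \<open>Connected sets of reals are convex, so the image contains the segment between any two of
  its points. Closed segments avoid cases on the order of \<open>u\<close>, \<open>v\<close> and of
  \<open>g u\<close>, \<open>g v\<close>.\<close>

lemma IVT_closed_segment:
  fixes g :: "real \<Rightarrow> real"
  assumes cont: "continuous_on (closed_segment u v) g" and "p \<in> closed_segment (g u) (g v)"
  obtains s where "s \<in> closed_segment u v" "g s = p"
proof -
  have "connected (g ` closed_segment u v)"
    using cont by (intro connected_continuous_image) auto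
  then have "convex (g ` closed_segment u v)"
    using is_interval_connected_1 is_interval_convex_1 by blast
  then have "closed_segment (g u) (g v) \<subseteq> g ` closed_segment u v"
    by (intro closed_segment_subset) auto
  then show ?thesis using assms(2) that by blast
qed

lemma bounded_local_oscillation:
  fixes f g :: "real \<Rightarrow> real"
  assumes nonconst: "\<not> f constant_on UNIV" and contg: "continuous_on UNIV g"
    and T: "T > 0" and per: "\<And>x. f (x + T) = f x"
    and unif: "uniformly_continuous_on UNIV (f \<circ> g)"
  obtains d where "d > 0" "\<And>u v. \<bar>u - v\<bar> \<le> d \<Longrightarrow> \<bar>g u - g v\<bar> \<le> T"
proof -
  obtain a b where "f a \<noteq> f b" using nonconst unfolding constant_on_def by blast
  then have "dist (f a) (f b) > 0" by simp
  then obtain d where d: "d > 0"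
    "\<And>s t. dist t s < d \<Longrightarrow> dist (f (g t)) (f (g s)) < dist (f a) (f b)"
    using unif unfolding uniformly_continuous_on_def by (metis UNIV_I comp_apply)
  \<comment> \<open>Halving \<open>d\<close> turns the strict bound of uniform continuity into a
    non-strict one.\<close>
  have "\<bar>g u - g v\<bar> \<le> T" if uv: "\<bar>u - v\<bar> \<le> d / 2" for u v
  proof (rule ccontr)
    assume far: "\<not> \<bar>g u - g v\<bar> \<le> T"
    let ?p = "min (g u) (g v)"
    \<comment> \<open>The values \<open>g u\<close> and \<open>g v\<close> are more than
      \<open>T\<close> apart, so the full period [?p, ?p + T] lies between them and \<open>g\<close>
      runs through all of it.\<close>
    have attained: "\<exists>s \<in> closed_segment u v. f (g s) = f c" for c
    proof -
      obtain c' where c': "?p \<le> c'" "c' \<le> ?p + T" "f c' = f c"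
        using periodic_representative[where f = f, OF T per] .
      then have "c' \<in> closed_segment (g u) (g v)"
        using far by (auto simp: closed_segment_eq_real_ivl)
      then show ?thesis
        using IVT_closed_segment[OF continuous_on_subset[OF contg subset_UNIV]] c'(3) by metis
    qed
    obtain s t where "s \<in> closed_segment u v" "t \<in> closed_segment u v"
      and st: "f (g s) = f b" "f (g t) = f a"
      using attained by meson
    then have "dist t s < d"
      using uv d(1) by (auto simp: closed_segment_eq_real_ivl dist_real_def split: if_splits)
    then show False using d(2) st by fastforce
  qed
  then show ?thesis using d(1) that[of "d / 2"] by simp
qed

text \<open>Cut the segment from \<open>v\<close> to \<open>u\<close> into equal pieces of length at
  most \<open>d\<close>; each contributes at most \<open>T\<close>, and rounding the number of
  pieces up costs the summand 1.\<close>

lemma linear_growth_of_local_oscillation: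
  fixes g :: "real \<Rightarrow> real"
  assumes d: "d > 0" and osc: "\<And>u v. \<bar>u - v\<bar> \<le> d \<Longrightarrow> \<bar>g u - g v\<bar> \<le> T"
  shows "\<bar>g u - g v\<bar> \<le> (\<bar>u - v\<bar> / d + 1) * T"
proof -
  have T: "T \<ge> 0" using osc[of 0 0] d by simp
  have steps: "\<bar>u - v\<bar> \<le> real n * d \<Longrightarrow> \<bar>g u - g v\<bar> \<le> real n * T" for n u v
  proof (induction n arbitrary: u)
    case (Suc n)
    \<comment> \<open>\<open>w\<close> splits off the one of \<open>Suc n\<close> equal pieces next
      to \<open>u\<close>; the other \<open>n\<close> pieces are left to the induction
      hypothesis.\<close>
    define w where "w = v + (u - v) * (n / Suc n)"
    have "u - w = (u - v) / Suc n" "w - v = (u - v) / Suc n * n"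
      unfolding w_def by (simp_all add: field_simps)
    moreover have "\<bar>u - v\<bar> / Suc n \<le> d" using Suc.prems by (simp add: field_simps)
    ultimately have "\<bar>u - w\<bar> \<le> d" "\<bar>w - v\<bar> \<le> n * d"
      using mult_right_mono[of "\<bar>u - v\<bar> / Suc n" d "real n"] by (auto simp: abs_mult mult.commute)
    then have "\<bar>g u - g w\<bar> \<le> T" "\<bar>g w - g v\<bar> \<le> n * T" using osc Suc.IH by auto
    then show ?case by (simp add: algebra_simps)
  qed simp
  define n where "n = nat \<lceil>\<bar>u - v\<bar> / d\<rceil>"
  have "0 \<le> \<bar>u - v\<bar> / d" using d by simp
  then have "\<bar>u - v\<bar> / d \<le> n" "n \<le> \<bar>u - v\<bar> / d + 1" unfolding n_def by linarith+
  moreover from this have "\<bar>u - v\<bar> \<le> n * d" using d by (simp add: field_simps)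
  ultimately show ?thesis using steps mult_right_mono[OF _ T] by (meson order_trans)
qed

theorem theorem1:
  fixes f g :: "real \<Rightarrow> real"
  assumes "\<not> f constant_on UNIV" and "\<not> g constant_on UNIV"
    and "continuous_on UNIV f" and "continuous_on UNIV g"
    and "periodic f"
    and "\<exists>x y :: nat \<Rightarrow> real.
           (INF n\<in>{1..}. \<bar>x n - y n\<bar>) > 0 \<and>
           filterlim (\<lambda>n. \<bar>(g (x n) - g (y n)) / (x n - y n)\<bar>) at_top sequentially"
  shows "\<not> periodic (f \<circ> g)"
proof
  assume "periodic (f \<circ> g)"
  then obtain S where S: "S > 0" "\<And>x. (f \<circ> g) (x + S) = (f \<circ> g) x"
    unfolding periodic_def by auto
  obtain T where T: "T > 0" "\<And>x. f (x + T) = f x"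
    using assms(5) unfolding periodic_def by auto
  obtain x y where inf: "(INF n\<in>{1..}. \<bar>x n - y n\<bar>) > 0"
    and lim: "filterlim (\<lambda>n. \<bar>(g (x n) - g (y n)) / (x n - y n)\<bar>) at_top sequentially"
    using assms(6) by auto
  define c where "c = (INF n\<in>{1..}. \<bar>x n - y n\<bar>)"
  have c: "c > 0" using inf by (simp add: c_def)
  \<comment> \<open>The infimum is a lower bound because 0 bounds the distances from below.\<close>
  have apart: "c \<le> \<bar>x n - y n\<bar>" if "n \<ge> 1" for n
    unfolding c_def using that by (intro cINF_lower) (auto intro!: bdd_belowI[of _ 0])
  have "continuous_on UNIV (f \<circ> g)"
    using assms(3,4) by (meson continuous_on_compose continuous_on_subset subset_UNIV)
  then have "uniformly_continuous_on UNIV (f \<circ> g)"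
    using S by (rule uniformly_continuous_periodic)
  then obtain d where d: "d > 0" "\<And>u v. \<bar>u - v\<bar> \<le> d \<Longrightarrow> \<bar>g u - g v\<bar> \<le> T"
    using bounded_local_oscillation[OF assms(1,4) T] by blast
  \<comment> \<open>Divided by the distance, the linear term of the growth bound gives
    \<open>T / d\<close>, and the constant term at most \<open>T / c\<close> since the points stay
    \<open>c\<close> apart.\<close>
  have bound: "\<bar>(g (x n) - g (y n)) / (x n - y n)\<bar> \<le> T / d + T / c" if "n \<ge> 1" for n
  proof -
    let ?r = "\<bar>x n - y n\<bar>"
    have r: "?r > 0" "c \<le> ?r" using apart[OF that] c by linarith+
    have "\<bar>g (x n) - g (y n)\<bar> / ?r \<le> (?r / d + 1) * T / ?r"
      using linear_growth_of_local_oscillation[OF d] r by (intro divide_right_mono) auto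
    also have "\<dots> = T / d + T / ?r" using r d(1) by (simp add: field_simps)
    also have "\<dots> \<le> T / d + T / c" using r c T(1) by (intro add_left_mono divide_left_mono) auto
    finally show ?thesis by simp
  qed
  have "eventually (\<lambda>n. \<bar>(g (x n) - g (y n)) / (x n - y n)\<bar> > T / d + T / c) sequentially"
    using lim by (simp add: filterlim_at_top_dense)
  \<comment> \<open>The bound concerns indices from 1 on, which is enough in the limit.\<close>
  then have "eventually (\<lambda>n. False) sequentially"
    using eventually_ge_at_top[of 1] by eventually_elim (use bound in force)
  then show False by simp
qed

end
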